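(* Let $(X,\mu)$ be a finite measure space and let $f(\cdot\,;n)$, $n\in\mathbb N$, be a sequence of nonnegative $L^1$ functions on $X$ such that for every $x\in X$ the numerical sequence $n\mapsto f(x;n)$ is nondecreasing. Set $F(n)=\int_X f(x;n)\,d\mu(x)$. Let $\varepsilon>0$ be arbitrary. 1. If $F(n)=O(n^p)$ for some $p>0$, then for almost every $x\in X$ we have $f(x;n)=O(n^{p+\varepsilon})$. 2. If $F(n)=O(e^{an})$ for some $a>0$, then for almost every $x\in X$ we have $f(x;n)=O(e^{(a+\varepsilon)n})$.
   Context: All $O(\cdot)$ bounds are as $n\to\infty$; the implied constants in the bounds for $f(x;n)$ may depend on $x$ and $\varepsilon$. *)

theory Defs
  imports "HOL-Analysis.Analysis" "HOL-Library.Landau_Symbols"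
begin

end

theory Submission
  imports Defs
begin

text \<open>Along a sparse sequence \<open>N k\<close>, the integrals of \<open>f x (N k) / g (N k)\<close> are summable, so by
  monotone convergence \<open>\<Sum>k. f x (N k) / g (N k)\<close> is finite for almost every \<open>x\<close>, and in particular
  its terms are bounded. Monotonicity in \<open>n\<close> fills the gaps, provided that each \<open>n\<close> lies
  below some \<open>N k\<close> with \<open>g (N k)\<close> comparable to \<open>g n\<close>: one takes \<open>N k = 2 ^ k\<close> for powers and
  \<open>N k = k\<close> for exponentials.\<close>

lemma AE_bigo_of_summable_integrals:
  fixes f :: "'a \<Rightarrow> nat \<Rightarrow> real" and g :: "nat \<Rightarrow> real" and N :: "nat \<Rightarrow> nat"
  assumes int: "\<And>n. integrable M (\<lambda>x. f x n)"
    and nonneg: "\<And>x n. x \<in> space M \<Longrightarrow> f x n \<ge> 0"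
    and mono: "\<And>x. x \<in> space M \<Longrightarrow> mono (f x)"
    and pos: "\<And>k. g (N k) > 0"
    and summable: "summable (\<lambda>k. (\<integral>x. f x (N k) \<partial>M) / g (N k))"
    and K: "K \<ge> 0"
    and dense: "eventually (\<lambda>n. \<exists>k. n \<le> N k \<and> g (N k) \<le> K * g n) at_top"
  shows "AE x in M. f x \<in> O(g)"
proof -
  define t where "t k x = f x (N k) / g (N k)" for k x
  have t_nonneg: "t k x \<ge> 0" if "x \<in> space M" for k x
    using nonneg[OF that] pos[of k] by (simp add: t_def)
  have t_int: "integrable M (t k)" for k
    unfolding t_def using int by simp
  have [measurable]: "t k \<in> borel_measurable M" for k
    using t_int by (rule borel_measurable_integrable)
  \<comment> \<open>Working in \<open>ennreal\<close> lets the sum and the integral be exchanged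
    before anything is known about pointwise convergence.\<close>
  have "(\<integral>\<^sup>+x. (\<Sum>k. ennreal (t k x)) \<partial>M) = (\<Sum>k. \<integral>\<^sup>+x. ennreal (t k x) \<partial>M)"
    by (intro nn_integral_suminf) measurable
  also have "\<dots> = (\<Sum>k. ennreal ((\<integral>x. f x (N k) \<partial>M) / g (N k)))"
  proof (rule arg_cong[where f = suminf], rule ext)
    fix k
    have "(\<integral>\<^sup>+x. ennreal (t k x) \<partial>M) = ennreal (\<integral>x. t k x \<partial>M)"
      using t_int t_nonneg by (intro nn_integral_eq_integral) auto
    then show "(\<integral>\<^sup>+x. ennreal (t k x) \<partial>M) = ennreal ((\<integral>x. f x (N k) \<partial>M) / g (N k))"
      by (simp add: t_def)
  qed
  also have "\<dots> \<noteq> \<infinity>"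
  proof -
    have "(\<integral>x. f x (N k) \<partial>M) / g (N k) \<ge> 0" for k
      using nonneg pos[of k] by (intro divide_nonneg_pos Bochner_Integration.integral_nonneg) auto
    then show ?thesis
      unfolding infinity_ennreal_def by (rule ennreal_suminf_neq_top[OF summable])
  qed
  finally have "AE x in M. (\<Sum>k. ennreal (t k x)) \<noteq> \<infinity>"
    by (intro nn_integral_PInf_AE) measurable
  then show ?thesis
  proof (rule AE_mp[OF _ AE_I2], intro impI)
    fix x assume x: "x \<in> space M" and fin: "(\<Sum>k. ennreal (t k x)) \<noteq> \<infinity>"
    \<comment> \<open>The value \<open>c\<close> of the series at this \<open>x\<close> dominates
      every single term. It is the source of the dependence of the implied constant on
      \<open>x\<close>.\<close>
    then obtain c where c: "c \<ge> 0" "(\<Sum>k. ennreal (t k x)) = ennreal c"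
      by (cases "\<Sum>k. ennreal (t k x)") auto
    have bound: "f x (N k) \<le> c * g (N k)" for k
    proof -
      have "ennreal (t k x) \<le> (\<Sum>k. ennreal (t k x))"
        using sum_le_suminf[of "\<lambda>k. ennreal (t k x)" "{k}"] by simp
      then have "t k x \<le> c"
        using c by simp
      then show ?thesis
        using pos[of k] by (simp add: t_def divide_le_eq)
    qed
    show "f x \<in> O(g)"
    proof (rule bigoI)
      \<comment> \<open>The factor \<open>c\<close> controls \<open>f x\<close> along
        \<open>N\<close>; the factor \<open>K\<close> pays for moving from \<open>n\<close> up to
        some \<open>N k\<close>.\<close>
      show "eventually (\<lambda>n. norm (f x n) \<le> c * K * norm (g n)) at_top"
        using dense
      proof eventually_elim
        case (elim n)
        then obtain k where k: "n \<le> N k" "g (N k) \<le> K * g n"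
          by blast
        have "norm (f x n) = f x n"
          using nonneg[OF x] by simp
        also have "\<dots> \<le> f x (N k)"
          using mono[OF x] k(1) by (rule monoD)
        also have "\<dots> \<le> c * g (N k)"
          by (rule bound)
        also have "\<dots> \<le> c * (K * g n)"
          using k(2) c(1) by (rule mult_left_mono)
        \<comment> \<open>The sign of \<open>g\<close> is prescribed only along \<open>N\<close>, so
          \<open>g n\<close> is replaced by its norm, which \<open>K \<ge> 0\<close>
          permits.\<close>
        also have "\<dots> \<le> c * (K * norm (g n))"
          using c(1) K by (intro mult_left_mono) auto
        finally show ?case
          by (simp add: mult.assoc)
      qed
    qed
  qed
qed

text \<open>The growth bound on \<open>F\<close> survives restriction to \<open>N\<close>, so only
  the explicit ratio \<open>h / g\<close> has to be summed. In both applications this is a geometric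
  series.\<close>

lemma summable_divide_of_bigo:
  fixes F g h :: "nat \<Rightarrow> real" and N :: "nat \<Rightarrow> nat"
  assumes "F \<in> O(h)" and "filterlim N at_top at_top"
    and pos: "\<And>k. g (N k) > 0"
    and summable: "summable (\<lambda>k. \<bar>h (N k) / g (N k)\<bar>)"
  shows "summable (\<lambda>k. F (N k) / g (N k))"
proof (rule summable_comparison_test_bigo)
  show "summable (\<lambda>k. norm (h (N k) / g (N k)))"
    using summable by simp
  have "(\<lambda>k. F (N k)) \<in> O(\<lambda>k. h (N k))"
    using assms(1,2) by (rule landau_o.big.compose)
  then show "(\<lambda>k. F (N k) / g (N k)) \<in> O(\<lambda>k. h (N k) / g (N k))"
    using pos by (intro landau_o.big.divide_right) (auto simp: less_imp_neq[symmetric])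
qed

lemma strict_mono_pow_two: "strict_mono (\<lambda>k. 2 ^ k :: nat)"
  by (rule strict_monoI) simp

text \<open>Doubling the largest power of two that does not exceed \<open>n\<close> passes
  \<open>n\<close> but stays within \<open>2 * n\<close>.\<close>

lemma ex_power_two_between:
  fixes n :: nat
  assumes "n \<ge> 1"
  shows "\<exists>k::nat. n \<le> 2 ^ k \<and> 2 ^ k \<le> 2 * n"
proof -
  obtain k where "2 ^ k \<le> n" "n < 2 ^ (k + 1)"
    using ex_power_ivl1[of 2 n] assms by auto
  then show ?thesis
    by (intro exI[of _ "k + 1"]) auto
qed

theorem proposition4:
  fixes M :: "'a measure" and f :: "'a \<Rightarrow> nat \<Rightarrow> real" and F :: "nat \<Rightarrow> real" and \<epsilon> :: real
  assumes "finite_measure M"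
    and "\<And>n. integrable M (\<lambda>x. f x n)"
    and "\<And>x n. x \<in> space M \<Longrightarrow> f x n \<ge> 0"
    and "\<And>x. x \<in> space M \<Longrightarrow> mono (f x)"
    and "\<And>n. F n = (\<integral>x. f x n \<partial>M)"
    and "\<epsilon> > 0"
  shows "(\<forall>p::real. p > 0 \<longrightarrow> F \<in> O(\<lambda>n. real n powr p) \<longrightarrow>
            (AE x in M. f x \<in> O(\<lambda>n. real n powr (p + \<epsilon>)))) \<and>
         (\<forall>a::real. a > 0 \<longrightarrow> F \<in> O(\<lambda>n. exp (a * real n)) \<longrightarrow>
            (AE x in M. f x \<in> O(\<lambda>n. exp ((a + \<epsilon>) * real n))))"
proof (intro conjI allI impI)
  fix p :: real
  assume p: "p > 0" and F: "F \<in> O(\<lambda>n. real n powr p)"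
  show "AE x in M. f x \<in> O(\<lambda>n. real n powr (p + \<epsilon>))"
  \<comment> \<open>Rounding \<open>n\<close> up to a power of two at most doubles it, which costs
    the factor \<open>2 powr (p + \<epsilon>)\<close>. Sparseness matters: over all \<open>n\<close>
    the comparison series of \<open>n powr - \<epsilon>\<close> diverges for small
    \<open>\<epsilon>\<close>.\<close>
  proof (rule AE_bigo_of_summable_integrals[where N = "\<lambda>k. 2 ^ k" and K = "2 powr (p + \<epsilon>)"])
    have "summable (\<lambda>k. (2 powr - \<epsilon>) ^ k)"
      using \<open>\<epsilon> > 0\<close> by (intro summable_geometric) (simp add: powr_less_one)
    also have "(\<lambda>k. (2 powr - \<epsilon>) ^ k) = (\<lambda>k. \<bar>real (2 ^ k) powr p / real (2 ^ k) powr (p + \<epsilon>)\<bar>)"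
    proof
      fix k
      have "\<bar>real (2 ^ k) powr p / real (2 ^ k) powr (p + \<epsilon>)\<bar> = (2 powr real k) powr (p - (p + \<epsilon>))"
        by (simp add: powr_realpow flip: powr_diff)
      also have "\<dots> = (2 powr - \<epsilon>) powr real k"
        by (simp add: powr_powr mult.commute)
      also have "\<dots> = (2 powr - \<epsilon>) ^ k"
        by (simp add: powr_realpow)
      finally show "(2 powr - \<epsilon>) ^ k = \<bar>real (2 ^ k) powr p / real (2 ^ k) powr (p + \<epsilon>)\<bar>"
        by (rule sym)
    qed
    finally have "summable (\<lambda>k. F (2 ^ k) / real (2 ^ k) powr (p + \<epsilon>))"
      by (intro summable_divide_of_bigo[OF F filterlim_subseq[OF strict_mono_pow_two],
            where g = "\<lambda>n. real n powr (p + \<epsilon>)"]) simp_all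
    then show "summable (\<lambda>k. (\<integral>x. f x (2 ^ k) \<partial>M) / real (2 ^ k) powr (p + \<epsilon>))"
      by (simp add: assms(5))
    show "eventually (\<lambda>n. \<exists>k. n \<le> 2 ^ k \<and>
        real (2 ^ k) powr (p + \<epsilon>) \<le> 2 powr (p + \<epsilon>) * real n powr (p + \<epsilon>)) at_top"
      \<comment> \<open>At \<open>n = 0\<close> the right-hand side is \<open>0\<close> while the
        left-hand side is positive.\<close>
      using eventually_ge_at_top[of 1]
    proof eventually_elim
      case (elim n)
      then obtain k where k: "n \<le> 2 ^ k" "2 ^ k \<le> 2 * n"
        using ex_power_two_between by blast
      have "real (2 ^ k) \<le> 2 * real n"
        using k(2) by (metis of_nat_le_iff of_nat_mult of_nat_numeral)
      then have "real (2 ^ k) powr (p + \<epsilon>) \<le> (2 * real n) powr (p + \<epsilon>)"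
        using p \<open>\<epsilon> > 0\<close> by (intro powr_mono2) auto
      then show ?case
        using k(1) by (auto simp: powr_mult)
    qed
  qed (use assms in auto)
next
  fix a :: real
  assume "a > 0" and F: "F \<in> O(\<lambda>n. exp (a * real n))"
  show "AE x in M. f x \<in> O(\<lambda>n. exp ((a + \<epsilon>) * real n))"
  \<comment> \<open>The ratio \<open>exp (- \<epsilon> * k)\<close> is already summable over all
    \<open>k\<close>, so there are no gaps to fill and \<open>k = n\<close> works with
    \<open>K = 1\<close>.\<close>
  proof (rule AE_bigo_of_summable_integrals[where N = "\<lambda>k. k" and K = 1])
    have "summable (\<lambda>k. exp (- \<epsilon>) ^ k)"
      using \<open>\<epsilon> > 0\<close> by (intro summable_geometric) simp
    also have "(\<lambda>k. exp (- \<epsilon>) ^ k) = (\<lambda>k. \<bar>exp (a * real k) / exp ((a + \<epsilon>) * real k)\<bar>)"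
      by (simp add: exp_diff[symmetric] exp_of_nat_mult[symmetric] algebra_simps)
    finally have "summable (\<lambda>k. F k / exp ((a + \<epsilon>) * real k))"
      by (intro summable_divide_of_bigo[OF F filterlim_ident,
            where g = "\<lambda>n. exp ((a + \<epsilon>) * real n)"]) simp_all
    then show "summable (\<lambda>k. (\<integral>x. f x k \<partial>M) / exp ((a + \<epsilon>) * real k))"
      by (simp add: assms(5))
    show "eventually (\<lambda>n. \<exists>k. n \<le> k \<and>
        exp ((a + \<epsilon>) * real k) \<le> 1 * exp ((a + \<epsilon>) * real n)) at_top"
      by (rule always_eventually) auto
  qed (use assms in auto)
qed

end
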